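(* Let $\{V_n : n\in\mathbb N\}$ be a sequence of uncorrelated $\mathcal P_{kc}(\mathbb R)$-valued random variables such that for each $n$ and each $x^*\in\mathbb R^*(=\mathbb R)$ the variance $\mathrm{Var}(\sigma(x^*,V_n))$ exists, and for every $x^*\in\mathbb R^*$, $$\frac{1}{n^2}\sum_{k=1}^{n}\mathrm{Var}(\sigma(x^*,V_k))\longrightarrow 0\quad\text{as } n\to\infty.$$ Then for every $\varepsilon>0$, $$P\Big\{d_H\Big(\frac1n\sum_{k=1}^n V_k,\ \frac1n\sum_{k=1}^n E[V_k]\Big)>\varepsilon\Big\}\longrightarrow 0\quad\text{as } n\to\infty.$$
   Context: $(\Omega,\mathcal A,\mu)$ is a complete, non-atomic probability space; $P$ denotes $\mu$, and $E$, $\mathrm{Var}$, $\mathrm{cov}$ are taken with respect to it. $\mathcal P_{kc}(\mathbb R)$ is the family of nonempty compact convex subsets of $\mathbb R$ (compact intervals). For nonempty sets $A,B$ and $\lambda\in\mathbb R$: $A+B=\{a+b:a\in A,b\in B\}$, $\lambda A=\{\lambda a:a\in A\}$; sums of sets are Minkowski sums. The Hausdorff metric is $d_H(A,B)=\max\{\sup_{a\in A}\inf_{b\in B}|a-b|,\ \sup_{b\in B}\inf_{a\in A}|a-b|\}$. The support function is $\sigma(x^*,A)=\sup_{a\in A}\langle x^*,a\rangle$, i.e. $\sup_{a\in A}x^*a$ for $x^*\in\mathbb R^*=\mathbb R$. A $\mathcal P_{kc}(\mathbb R)$-valued random variable is a map $F:\Omega\to\mathcal P_{kc}(\mathbb R)$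 such that $\{\omega: F(\omega)\cap O\ne\emptyset\}\in\mathcal A$ for every open $O\subset\mathbb R$. Its expectation is the Aumann integral $E[F]=\{E[f]: f\in S_F\}$, where $S_F$ is the set of integrable $f:\Omega\to\mathbb R$ with $f(\omega)\in F(\omega)$ a.s. Real random variables $\xi,\eta$ are uncorrelated if $\mathrm{cov}(\xi,\eta)=0$. A sequence of set-valued random variables $\{F_1,F_2,\dots\}$ is (pairwise) uncorrelated if for every $x^*\in\mathbb R^*$ the real random variables $\sigma(x^*,F_1),\sigma(x^*,F_2),\dots$ are pairwise uncorrelated. *)

theory Defs
  imports "HOL-Probability.Probability" "HOL-Library.Set_Algebras"
begin

text \<open>
  Minkowski sums \<open>A + B\<close> and dilations \<open>c *o A = {c * a | a. a \<in> A}\<close> are those of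
  \<open>HOL-Library.Set_Algebras\<close>; the empty Minkowski sum is \<open>{0}\<close>.
\<close>

definition nonatomic :: "'a measure \<Rightarrow> bool" where
  "nonatomic M \<longleftrightarrow>
    (\<forall>A\<in>sets M. 0 < emeasure M A \<longrightarrow>
      (\<exists>B\<in>sets M. B \<subseteq> A \<and> 0 < emeasure M B \<and> emeasure M B < emeasure M A))"

text \<open>
  The real-valued suprema and infima below are meaningful for nonempty bounded sets, in
  particular for nonempty compact ones.
\<close>

definition hausdorff_dist :: "real set \<Rightarrow> real set \<Rightarrow> real" where
  "hausdorff_dist A B =
    max (SUP a\<in>A. INF b\<in>B. \<bar>a - b\<bar>) (SUP b\<in>B. INF a\<in>A. \<bar>a - b\<bar>)"

definition support_fun :: "real \<Rightarrow> real set \<Rightarrow> real" where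
  "support_fun x A = (SUP a\<in>A. x * a)"

definition P_kc :: "real set set" where
  "P_kc = {A. A \<noteq> {} \<and> compact A \<and> convex A}"

definition kc_random_variable :: "'a measure \<Rightarrow> ('a \<Rightarrow> real set) \<Rightarrow> bool" where
  "kc_random_variable M F \<longleftrightarrow>
    F \<in> space M \<rightarrow> P_kc \<and>
    (\<forall>U. open U \<longrightarrow> {\<omega> \<in> space M. F \<omega> \<inter> U \<noteq> {}} \<in> sets M)"

definition integrable_selections :: "'a measure \<Rightarrow> ('a \<Rightarrow> real set) \<Rightarrow> ('a \<Rightarrow> real) set" where
  "integrable_selections M F = {f. integrable M f \<and> (AE \<omega> in M. f \<omega> \<in> F \<omega>)}"

definition aumann_expectation :: "'a measure \<Rightarrow> ('a \<Rightarrow> real set) \<Rightarrow> real set" where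
  "aumann_expectation M F = {(\<integral>\<omega>. f \<omega> \<partial>M) | f. f \<in> integrable_selections M F}"

definition variance_exists :: "'a measure \<Rightarrow> ('a \<Rightarrow> real) \<Rightarrow> bool" where
  "variance_exists M X \<longleftrightarrow>
    integrable M X \<and> integrable M (\<lambda>\<omega>. (X \<omega> - prob_space.expectation M X)\<^sup>2)"

definition cov :: "'a measure \<Rightarrow> ('a \<Rightarrow> real) \<Rightarrow> ('a \<Rightarrow> real) \<Rightarrow> real" where
  "cov M X Y = prob_space.expectation M
    (\<lambda>\<omega>. (X \<omega> - prob_space.expectation M X) * (Y \<omega> - prob_space.expectation M Y))"

text \<open>
  A non-integrable function has integral \<open>0\<close> in the library, so the existence of the
  covariance is required explicitly.
\<close>

definition uncorrelated :: "'a measure \<Rightarrow> ('a \<Rightarrow> real) \<Rightarrow> ('a \<Rightarrow> real) \<Rightarrow> bool" where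
  "uncorrelated M X Y \<longleftrightarrow>
    integrable M X \<and> integrable M Y \<and>
    integrable M (\<lambda>\<omega>. (X \<omega> - prob_space.expectation M X) * (Y \<omega> - prob_space.expectation M Y)) \<and>
    cov M X Y = 0"

text \<open>Sequences are indexed by the positive integers; the entry at index \<open>0\<close> is irrelevant.\<close>

definition uncorrelated_seq :: "'a measure \<Rightarrow> (nat \<Rightarrow> 'a \<Rightarrow> real set) \<Rightarrow> bool" where
  "uncorrelated_seq M F \<longleftrightarrow>
    (\<forall>x. pairwise (\<lambda>i j. uncorrelated M (\<lambda>\<omega>. support_fun x (F i \<omega>))
                                       (\<lambda>\<omega>. support_fun x (F j \<omega>))) {1..})"

end

theory Submission
  imports Defs
begin

text \<open>
  A compact convex subset \<open>A\<close> of the line is the interval whose right endpoint is the support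
  function at \<open>1\<close> and whose left endpoint is minus the support function at \<open>-1\<close>. Minkowski sums,
  dilations and Aumann expectations act endpointwise, and the Hausdorff distance of two intervals is
  at most the larger of the distances between corresponding endpoints. The theorem thus follows
  from Chebyshev's inequality for the two real uncorrelated sequences of endpoints.
\<close>

section \<open>Compact intervals: endpoints, arithmetic, distance and Aumann expectation\<close>

lemma P_kc_eq_interval:
  assumes "A \<in> P_kc"
  shows "A = {- support_fun (-1) A .. support_fun 1 A}"
    and "- support_fun (-1) A \<le> support_fun 1 A"
proof -
  from assms have "A \<noteq> {}" "compact A" "connected A"
    by (auto simp: P_kc_def convex_connected)
  then obtain a b where A: "A = {a..b}" "a \<le> b"
    using connected_compact_interval_1[of A] by auto
  have "support_fun 1 A = b"
    using A by (simp add: support_fun_def)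
  \<comment> \<open>Multiplication by \<open>-1\<close> reverses the order, so the supremum is
    attained at the left endpoint.\<close>
  moreover have "support_fun (-1) A = - a"
    unfolding support_fun_def by (rule cSup_eq_maximum) (use A in auto)
  ultimately show "A = {- support_fun (-1) A .. support_fun 1 A}"
    and "- support_fun (-1) A \<le> support_fun 1 A"
    using A by auto
qed

lemma interval_plus_interval:
  fixes a b c d :: real
  assumes "a \<le> b" "c \<le> d"
  shows "{a..b} + {c..d} = {a + c..b + d}"
proof
  show "{a..b} + {c..d} \<subseteq> {a + c..b + d}"
    by (auto simp: set_plus_def)
  show "{a + c..b + d} \<subseteq> {a..b} + {c..d}"
  proof
    fix x assume x: "x \<in> {a + c..b + d}"
    \<comment> \<open>A summand \<open>y\<close> is admissible iff it lies in both
      \<open>{a..b}\<close> and \<open>{x - d..x - c}\<close>. These intervals meet by the bounds on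
      \<open>x\<close>, and the larger of their left ends is the least common point.\<close>
    define y where "y = max a (x - d)"
    have "y \<in> {a..b}" "x - y \<in> {c..d}"
      using x assms by (auto simp: y_def)
    then have "y + (x - y) \<in> {a..b} + {c..d}"
      by (rule set_plus_intro)
    then show "x \<in> {a..b} + {c..d}" by simp
  qed
qed

lemma sum_intervals:
  fixes a b :: "'i \<Rightarrow> real"
  assumes "finite I" "\<And>i. i \<in> I \<Longrightarrow> a i \<le> b i"
  shows "(\<Sum>i\<in>I. {a i..b i}) = {sum a I..sum b I}"
  using assms
proof (induction I rule: finite_induct)
  case empty
  then show ?case by (simp add: set_zero)
next
  case (insert i I)
  then show ?case by (simp add: interval_plus_interval sum_mono)
qed

text \<open>The case \<open>c = 0\<close> is included because \<open>1 / real n\<close> is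
  \<open>0\<close> at \<open>n = 0\<close>; as the interval is nonempty, both sides are then
  \<open>{0}\<close>.\<close>

lemma scaled_interval:
  fixes a b c :: real
  assumes "0 \<le> c" "a \<le> b"
  shows "c *o {a..b} = {c * a..c * b}"
proof -
  have "c *o {a..b} = (*) c ` {a..b}"
    by (auto simp: elt_set_times_def)
  then show ?thesis
    using assms by (simp add: image_mult_atLeastAtMost_if)
qed

text \<open>The nearest point of \<open>{c..d}\<close> to \<open>x\<close> is the clamped value
  \<open>max c (min d x)\<close>. If it differs from \<open>x\<close>, then either
  \<open>x < c\<close> and the distance \<open>c - x\<close> is at most \<open>c - a\<close>, or
  \<open>x > d\<close> and the distance \<open>x - d\<close> is at most
  \<open>b - d\<close>.\<close>

lemma SUP_INF_dist_interval_le: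
  fixes a b c d :: real
  assumes "a \<le> b" "c \<le> d"
  shows "(SUP x\<in>{a..b}. INF y\<in>{c..d}. \<bar>x - y\<bar>) \<le> max \<bar>a - c\<bar> \<bar>b - d\<bar>"
proof (rule cSUP_least)
  show "{a..b} \<noteq> {}" using assms by simp
next
  fix x assume x: "x \<in> {a..b}"
  have "bdd_below ((\<lambda>y. \<bar>x - y\<bar>) ` {c..d})"
    by (rule bdd_belowI[where m = 0]) auto
  moreover have "max c (min d x) \<in> {c..d}"
    using assms by auto
  moreover have "\<bar>x - max c (min d x)\<bar> \<le> max \<bar>a - c\<bar> \<bar>b - d\<bar>"
    using x assms by (auto simp: max_def min_def)
  ultimately show "(INF y\<in>{c..d}. \<bar>x - y\<bar>) \<le> max \<bar>a - c\<bar> \<bar>b - d\<bar>"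
    by (rule cINF_lower2)
qed

lemma hausdorff_dist_interval_le:
  assumes "a \<le> b" "c \<le> d"
  shows "hausdorff_dist {a..b} {c..d} \<le> max \<bar>a - c\<bar> \<bar>b - d\<bar>"
  using SUP_INF_dist_interval_le[OF assms] SUP_INF_dist_interval_le[OF assms(2,1)]
  by (simp add: hausdorff_dist_def abs_minus_commute)

text \<open>Integrating \<open>l \<le> f \<le> u\<close> confines the mean of every selection.
  Conversely, a point between the two means is a convex combination of them, and the same constant
  weight applied pointwise to \<open>l\<close> and \<open>u\<close> yields an integrable selection
  with that mean.\<close>

lemma (in prob_space) aumann_expectation_interval:
  assumes F: "\<And>\<omega>. \<omega> \<in> space M \<Longrightarrow> F \<omega> = {l \<omega>..u \<omega>}"
    and le: "\<And>\<omega>. \<omega> \<in> space M \<Longrightarrow> l \<omega> \<le> u \<omega>"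
    and int: "integrable M l" "integrable M u"
  shows "aumann_expectation M F = {expectation l..expectation u}"
proof
  show "aumann_expectation M F \<subseteq> {expectation l..expectation u}"
  proof
    fix x assume "x \<in> aumann_expectation M F"
    then obtain f where x: "x = expectation f" and f: "integrable M f" "AE \<omega> in M. f \<omega> \<in> F \<omega>"
      by (auto simp: aumann_expectation_def integrable_selections_def)
    have "AE \<omega> in M. l \<omega> \<le> f \<omega> \<and> f \<omega> \<le> u \<omega>"
      using f(2) AE_space by eventually_elim (auto simp: F)
    then have "AE \<omega> in M. l \<omega> \<le> f \<omega>" "AE \<omega> in M. f \<omega> \<le> u \<omega>"
      by auto
    then show "x \<in> {expectation l..expectation u}"
      using f(1) int by (auto simp: x intro: integral_mono_AE)
  qed
  show "{expectation l..expectation u} \<subseteq> aumann_expectation M F"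
  proof
    fix x assume "x \<in> {expectation l..expectation u}"
    \<comment> \<open>The segment form supplies the weight \<open>t\<close> without a division,
      hence also when the two means coincide.\<close>
    then have "x \<in> closed_segment (expectation l) (expectation u)"
      by (auto simp: closed_segment_eq_real_ivl)
    then obtain t where t: "0 \<le> t" "t \<le> 1"
      and x: "x = (1 - t) * expectation l + t * expectation u"
      by (auto simp: closed_segment_def)
    define f where "f = (\<lambda>\<omega>. (1 - t) * l \<omega> + t * u \<omega>)"
    have "f \<omega> \<in> F \<omega>" if "\<omega> \<in> space M" for \<omega>
    proof -
      have "f \<omega> \<in> closed_segment (l \<omega>) (u \<omega>)"
        using t by (auto simp: f_def closed_segment_def)
      then show ?thesis
        using le[OF that] by (simp add: F[OF that] closed_segment_eq_real_ivl)
    qed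
    then have "f \<in> integrable_selections M F"
      using int by (auto simp: integrable_selections_def f_def)
    moreover have "x = expectation f"
      using int by (simp add: x f_def)
    ultimately show "x \<in> aumann_expectation M F"
      by (auto simp: aumann_expectation_def)
  qed
qed

section \<open>The weak law for uncorrelated real random variables\<close>

text \<open>The square of the centred sum expands into a double sum of products. Its diagonal terms
  have the variances as means, its off-diagonal terms the vanishing covariances.\<close>

lemma (in prob_space) variance_sum_uncorrelated:
  fixes X :: "'i \<Rightarrow> 'a \<Rightarrow> real"
  assumes "finite I"
    and var: "\<And>i. i \<in> I \<Longrightarrow> variance_exists M (X i)"
    and unc: "pairwise (\<lambda>i j. uncorrelated M (X i) (X j)) I"
  shows "integrable M (\<lambda>\<omega>. (\<Sum>i\<in>I. X i \<omega> - expectation (X i))\<^sup>2)"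
    and "expectation (\<lambda>\<omega>. (\<Sum>i\<in>I. X i \<omega> - expectation (X i))\<^sup>2) = (\<Sum>i\<in>I. variance (X i))"
proof -
  define Y where "Y i \<omega> = X i \<omega> - expectation (X i)" for i \<omega>
  \<comment> \<open>Needed to exchange expectation and double sum: on the diagonal this is the
    existence of the variance, off the diagonal it is part of \<open>uncorrelated\<close>.\<close>
  have int: "integrable M (\<lambda>\<omega>. Y i \<omega> * Y j \<omega>)" if "i \<in> I" "j \<in> I" for i j
    using var[OF that(1)] pairwiseD[OF unc that]
    by (cases "i = j") (auto simp: Y_def variance_exists_def uncorrelated_def power2_eq_square)
  have E: "expectation (\<lambda>\<omega>. Y i \<omega> * Y j \<omega>) = (if i = j then variance (X i) else 0)"
    if "i \<in> I" "j \<in> I" for i j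
    using pairwiseD[OF unc that]
    by (auto simp: Y_def uncorrelated_def cov_def power2_eq_square)
  have sq: "(\<lambda>\<omega>. (\<Sum>i\<in>I. X i \<omega> - expectation (X i))\<^sup>2) = (\<lambda>\<omega>. \<Sum>i\<in>I. \<Sum>j\<in>I. Y i \<omega> * Y j \<omega>)"
    by (simp add: Y_def power2_eq_square sum_product)
  show "integrable M (\<lambda>\<omega>. (\<Sum>i\<in>I. X i \<omega> - expectation (X i))\<^sup>2)"
    unfolding sq by (intro Bochner_Integration.integrable_sum int)
  have "expectation (\<lambda>\<omega>. \<Sum>i\<in>I. \<Sum>j\<in>I. Y i \<omega> * Y j \<omega>)
      = (\<Sum>i\<in>I. \<Sum>j\<in>I. expectation (\<lambda>\<omega>. Y i \<omega> * Y j \<omega>))"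
    by (simp add: int)
  also have "\<dots> = (\<Sum>i\<in>I. \<Sum>j\<in>I. if i = j then variance (X i) else 0)"
    by (intro sum.cong refl E)
  also have "\<dots> = (\<Sum>i\<in>I. variance (X i))"
    using \<open>finite I\<close> by simp
  finally show "expectation (\<lambda>\<omega>. (\<Sum>i\<in>I. X i \<omega> - expectation (X i))\<^sup>2) = (\<Sum>i\<in>I. variance (X i))"
    unfolding sq .
qed

text \<open>Chebyshev's inequality: Markov's inequality for the square of the centred average bounds
  the probability by the quantity in \<open>lim\<close> divided by
  \<open>\<epsilon>\<^sup>2\<close>.\<close>

lemma (in prob_space) weak_law_uncorrelated:
  fixes X :: "nat \<Rightarrow> 'a \<Rightarrow> real"
  assumes var: "\<And>n. n \<ge> 1 \<Longrightarrow> variance_exists M (X n)"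
    and unc: "pairwise (\<lambda>i j. uncorrelated M (X i) (X j)) {1..}"
    and lim: "(\<lambda>n. 1 / (real n)\<^sup>2 * (\<Sum>k=1..n. variance (X k))) \<longlonglongrightarrow> 0"
    and "\<epsilon> > 0"
  shows "(\<lambda>n. prob {\<omega> \<in> space M. \<epsilon> < \<bar>1 / real n * (\<Sum>k=1..n. X k \<omega> - expectation (X k))\<bar>})
           \<longlonglongrightarrow> 0"
proof (rule tendsto_sandwich[OF _ _ tendsto_const])
  show "(\<lambda>n. 1 / (real n)\<^sup>2 * (\<Sum>k=1..n. variance (X k)) / \<epsilon>\<^sup>2) \<longlonglongrightarrow> 0"
    using tendsto_divide[OF lim tendsto_const[of "\<epsilon>\<^sup>2"]] \<open>\<epsilon> > 0\<close> by simp
  show "\<forall>\<^sub>F n in sequentially.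
      prob {\<omega> \<in> space M. \<epsilon> < \<bar>1 / real n * (\<Sum>k=1..n. X k \<omega> - expectation (X k))\<bar>}
      \<le> 1 / (real n)\<^sup>2 * (\<Sum>k=1..n. variance (X k)) / \<epsilon>\<^sup>2"
  \<comment> \<open>The bound holds for every \<open>n\<close>, including \<open>n = 0\<close>,
    where the average and the right-hand side are both \<open>0\<close>.\<close>
  proof (intro always_eventually allI)
    fix n
    define S where "S \<omega> = (\<Sum>k=1..n. X k \<omega> - expectation (X k))" for \<omega>
    have "pairwise (\<lambda>i j. uncorrelated M (X i) (X j)) {1..n}"
      by (rule pairwise_subset[OF unc]) auto
    then have S2: "integrable M (\<lambda>\<omega>. (S \<omega>)\<^sup>2)"
        "expectation (\<lambda>\<omega>. (S \<omega>)\<^sup>2) = (\<Sum>k=1..n. variance (X k))"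
      unfolding S_def by (auto intro!: variance_sum_uncorrelated var)
    have "integrable M (\<lambda>\<omega>. (1 / real n * S \<omega>)\<^sup>2)"
      using S2(1) by (simp add: power_mult_distrib power_divide)
    note markov = integral_Markov_inequality_measure[OF this, of "space M" "\<epsilon>\<^sup>2"]
    \<comment> \<open>Squaring turns the strict deviation event into a subset of the non-strict
      event to which Markov's inequality applies.\<close>
    have "{\<omega> \<in> space M. \<epsilon> < \<bar>1 / real n * S \<omega>\<bar>} \<subseteq> {\<omega> \<in> space M. \<epsilon>\<^sup>2 \<le> (1 / real n * S \<omega>)\<^sup>2}"
    proof safe
      fix \<omega> assume "\<epsilon> < \<bar>1 / real n * S \<omega>\<bar>"
      then show "\<epsilon>\<^sup>2 \<le> (1 / real n * S \<omega>)\<^sup>2"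
        using \<open>\<epsilon> > 0\<close> by (metis abs_ge_zero less_imp_le power2_abs power_mono)
    qed
    moreover have "{\<omega> \<in> space M. \<epsilon>\<^sup>2 \<le> (1 / real n * S \<omega>)\<^sup>2} \<in> events"
      using borel_measurable_integrable[OF \<open>integrable M (\<lambda>\<omega>. (1 / real n * S \<omega>)\<^sup>2)\<close>] by measurable
    ultimately have "prob {\<omega> \<in> space M. \<epsilon> < \<bar>1 / real n * S \<omega>\<bar>}
        \<le> prob {\<omega> \<in> space M. \<epsilon>\<^sup>2 \<le> (1 / real n * S \<omega>)\<^sup>2}"
      by (rule finite_measure_mono)
    also have "\<dots> \<le> expectation (\<lambda>\<omega>. (1 / real n * S \<omega>)\<^sup>2) / \<epsilon>\<^sup>2"
      using markov \<open>\<epsilon> > 0\<close> by simp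
    also have "\<dots> = 1 / (real n)\<^sup>2 * (\<Sum>k=1..n. variance (X k)) / \<epsilon>\<^sup>2"
      by (simp add: power_mult_distrib power_divide S2(2))
    finally show "prob {\<omega> \<in> space M. \<epsilon> < \<bar>1 / real n * (\<Sum>k=1..n. X k \<omega> - expectation (X k))\<bar>}
      \<le> 1 / (real n)\<^sup>2 * (\<Sum>k=1..n. variance (X k)) / \<epsilon>\<^sup>2"
      unfolding S_def .
  qed
qed auto

section \<open>From the endpoints to the sets\<close>

theorem theorem3p2:
  fixes M :: "'a measure" and V :: "nat \<Rightarrow> 'a \<Rightarrow> real set"
  assumes "prob_space M" and "complete_measure M" and "nonatomic M"
    and "\<And>n. n \<ge> 1 \<Longrightarrow> kc_random_variable M (V n)"
    and "uncorrelated_seq M V"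
    and "\<And>n x. n \<ge> 1 \<Longrightarrow> variance_exists M (\<lambda>\<omega>. support_fun x (V n \<omega>))"
    and "\<And>x. (\<lambda>n. 1 / (real n)\<^sup>2 *
            (\<Sum>k=1..n. prob_space.variance M (\<lambda>\<omega>. support_fun x (V k \<omega>)))) \<longlonglongrightarrow> 0"
  shows "\<forall>\<epsilon>>0. (\<lambda>n. prob_space.prob M {\<omega> \<in> space M.
            hausdorff_dist ((1 / real n) *o (\<Sum>k=1..n. V k \<omega>))
              ((1 / real n) *o (\<Sum>k=1..n. aumann_expectation M (V k))) > \<epsilon>}) \<longlonglongrightarrow> 0"
proof (intro allI impI)
  fix \<epsilon> :: real assume "\<epsilon> > 0"
  interpret prob_space M by fact
  define s where "s x k \<omega> = support_fun x (V k \<omega>)" for x k \<omega>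
  \<comment> \<open>The deviation event in direction \<open>x\<close>: direction \<open>1\<close>
    governs the right endpoints, direction \<open>-1\<close> the negated left ones.\<close>
  define B where "B x n = {\<omega> \<in> space M.
    \<epsilon> < \<bar>1 / real n * (\<Sum>k=1..n. s x k \<omega> - expectation (s x k))\<bar>}" for x n
  have var: "variance_exists M (s x n)" if "n \<ge> 1" for x n
    using assms(6)[OF that, of x] by (simp add: s_def[abs_def])
  have int: "integrable M (s x n)" if "n \<ge> 1" for x n
    using var[OF that] by (simp add: variance_exists_def)
  have V: "V k \<omega> = {- s (-1) k \<omega> .. s 1 k \<omega>}" and le: "- s (-1) k \<omega> \<le> s 1 k \<omega>"
    if "k \<ge> 1" "\<omega> \<in> space M" for k \<omega>
  proof -
    have "V k \<omega> \<in> P_kc"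
      using assms(4)[OF that(1)] that(2) by (auto simp: kc_random_variable_def)
    then show "V k \<omega> = {- s (-1) k \<omega> .. s 1 k \<omega>}" "- s (-1) k \<omega> \<le> s 1 k \<omega>"
      unfolding s_def by (rule P_kc_eq_interval)+
  qed
  have EV: "aumann_expectation M (V k) = {- expectation (s (-1) k) .. expectation (s 1 k)}"
    if "k \<ge> 1" for k
    using aumann_expectation_interval[of "V k" "\<lambda>\<omega>. - s (-1) k \<omega>" "s 1 k"] V le int that by simp
  \<comment> \<open>The expected intervals must be nonempty for their Minkowski sum to be computed
    endpointwise.\<close>
  have Ele: "- expectation (s (-1) k) \<le> expectation (s 1 k)" if "k \<ge> 1" for k
    using integral_mono[of M "\<lambda>\<omega>. - s (-1) k \<omega>" "s 1 k"] int le that by simp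
  have B_lim: "(\<lambda>n. prob (B x n)) \<longlonglongrightarrow> 0" for x
    unfolding B_def
  proof (rule weak_law_uncorrelated[OF var _ _ \<open>\<epsilon> > 0\<close>])
    show "pairwise (\<lambda>i j. uncorrelated M (s x i) (s x j)) {1..}"
      using assms(5) by (simp add: uncorrelated_seq_def s_def[abs_def])
    show "(\<lambda>n. 1 / (real n)\<^sup>2 * (\<Sum>k=1..n. variance (s x k))) \<longlonglongrightarrow> 0"
      using assms(7)[of x] by (simp add: s_def[abs_def])
  qed simp
  have B_ev: "B x n \<in> events" for x n
  proof -
    have [measurable]: "s x k \<in> borel_measurable M" if "k \<in> {1..n}" for k
      using int[of k x] that by auto
    show ?thesis unfolding B_def by measurable
  qed
  let ?D = "\<lambda>n. {\<omega> \<in> space M. hausdorff_dist ((1 / real n) *o (\<Sum>k=1..n. V k \<omega>))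
              ((1 / real n) *o (\<Sum>k=1..n. aumann_expectation M (V k))) > \<epsilon>}"
  \<comment> \<open>Both averages are intervals, so a Hausdorff distance above
    \<open>\<epsilon>\<close> forces a gap above \<open>\<epsilon>\<close> at the left or at the
    right endpoint.\<close>
  have D_sub: "?D n \<subseteq> B (-1) n \<union> B 1 n" for n
  proof
    fix \<omega> assume \<omega>: "\<omega> \<in> ?D n"
    define c where "c = 1 / real n"
    define a where "a = (\<Sum>k=1..n. - s (-1) k \<omega>)"
    define b where "b = (\<Sum>k=1..n. s 1 k \<omega>)"
    define a' where "a' = (\<Sum>k=1..n. - expectation (s (-1) k))"
    define b' where "b' = (\<Sum>k=1..n. expectation (s 1 k))"
    have "c \<ge> 0" by (simp add: c_def)
    have ab: "a \<le> b" "a' \<le> b'"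
      using \<omega> by (auto simp: a_def b_def a'_def b'_def intro!: sum_mono le Ele simp del: sum_negf)
    have "(\<Sum>k=1..n. V k \<omega>) = (\<Sum>k=1..n. {- s (-1) k \<omega> .. s 1 k \<omega>})"
      using \<omega> by (intro sum.cong V) auto
    also have "\<dots> = {a..b}"
      unfolding a_def b_def using \<omega> by (intro sum_intervals le) auto
    finally have 1: "c *o (\<Sum>k=1..n. V k \<omega>) = {c * a..c * b}"
      using \<open>c \<ge> 0\<close> ab by (simp add: scaled_interval)
    have "(\<Sum>k=1..n. aumann_expectation M (V k))
        = (\<Sum>k=1..n. {- expectation (s (-1) k) .. expectation (s 1 k)})"
      by (intro sum.cong EV) auto
    also have "\<dots> = {a'..b'}"
      unfolding a'_def b'_def by (intro sum_intervals Ele) auto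
    finally have 2: "c *o (\<Sum>k=1..n. aumann_expectation M (V k)) = {c * a'..c * b'}"
      using \<open>c \<ge> 0\<close> ab by (simp add: scaled_interval)
    have "\<epsilon> < hausdorff_dist {c * a..c * b} {c * a'..c * b'}"
      using \<omega> unfolding mem_Collect_eq c_def[symmetric] 1 2 by blast
    also have "\<dots> \<le> max \<bar>c * a - c * a'\<bar> \<bar>c * b - c * b'\<bar>"
      using ab \<open>c \<ge> 0\<close> by (intro hausdorff_dist_interval_le mult_left_mono)
    \<comment> \<open>The left endpoints are minus the support function at \<open>-1\<close>; the
      resulting sign disappears under the absolute value in \<open>B\<close>.\<close>
    also have "c * a - c * a' = - (c * (\<Sum>k=1..n. s (-1) k \<omega> - expectation (s (-1) k)))"
      by (simp add: a_def a'_def sum_negf sum_subtractf algebra_simps)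
    also have "c * b - c * b' = c * (\<Sum>k=1..n. s 1 k \<omega> - expectation (s 1 k))"
      by (simp add: b_def b'_def sum_subtractf algebra_simps)
    finally show "\<omega> \<in> B (-1) n \<union> B 1 n"
      using \<omega> by (auto simp: B_def c_def less_max_iff_disj)
  qed
  show "(\<lambda>n. prob (?D n)) \<longlonglongrightarrow> 0"
  proof (rule tendsto_sandwich[OF _ _ tendsto_const])
    show "(\<lambda>n. prob (B (-1) n) + prob (B 1 n)) \<longlonglongrightarrow> 0"
      using tendsto_add[OF B_lim[of "-1"] B_lim[of 1]] by simp
    show "\<forall>\<^sub>F n in sequentially. prob (?D n) \<le> prob (B (-1) n) + prob (B 1 n)"
    proof (intro always_eventually allI)
      fix n
      \<comment> \<open>Monotonicity asks for measurability of the larger set only, which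
        \<open>B_ev\<close> provides.\<close>
      have "prob (?D n) \<le> prob (B (-1) n \<union> B 1 n)"
        by (intro finite_measure_mono D_sub sets.Un B_ev)
      also have "\<dots> \<le> prob (B (-1) n) + prob (B 1 n)"
        by (intro measure_Un_le B_ev)
      finally show "prob (?D n) \<le> prob (B (-1) n) + prob (B 1 n)" .
    qed
  qed auto
qed

end
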